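(* Let $E=(E^0,E^1,d_E,r_E)$ and $F=(F^0,F^1,d_F,r_F)$ be topological graphs and let $m=(m^0,m^1)$ be a factor map from $F$ to $E$. Let $\mu^0\colon C_0(E^0)\to C_0(F^0)$, $\mu^0(f)=f\circ m^0$, and $\mu^1\colon C_{d_E}(E^1)\to C_{d_F}(F^1)$, $\mu^1(\xi)=\xi\circ m^1$, be the maps induced by $m$. Let $T_E=(T_E^0,T_E^1)$ and $T_F=(T_F^0,T_F^1)$ be the universal Toeplitz $E$-pair in $\mathcal{T}(E)$ and the universal Toeplitz $F$-pair in $\mathcal{T}(F)$, respectively. Then there exists a unique $*$-homomorphism $\mu\colon\mathcal{T}(E)\to\mathcal{T}(F)$ such that $\mu\circ T_E^i=T_F^i\circ\mu^i$ for $i=0,1$.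
   Context: A topological graph $E=(E^0,E^1,d,r)$ consists of two locally compact (Hausdorff) spaces $E^0,E^1$, a local homeomorphism $d\colon E^1\to E^0$ and a continuous map $r\colon E^1\to E^0$. $C_d(E^1)$ is the set of continuous functions $\xi$ on $E^1$ such that $\langle\xi,\xi\rangle(v)=\sum_{e\in d^{-1}(v)}|\xi(e)|^2<\infty$ for all $v\in E^0$ and $\langle\xi,\xi\rangle\in C_0(E^0)$. It is a right Hilbert $C_0(E^0)$-module with $(\xi f)(e)=\xi(e)f(d(e))$ and $\langle\xi,\eta\rangle(v)=\sum_{e\in d^{-1}(v)}\overline{\xi(e)}\eta(e)$. The left action $\pi_r$ of $C_0(E^0)$ is $(\pi_r(f)\xi)(e)=f(r(e))\xi(e)$. A Toeplitz $E$-pair in a $C^*$-algebra $A$ is a pair $T=(T^0,T^1)$ of a $*$-homomorphism $T^0\colon C_0(E^0)\to A$ and a linear map $T^1\colon C_d(E^1)\to A$ with $T^1(\xi)^*T^1(\eta)=T^0(\langle\xi,\eta\rangle)$ and $T^0(f)T^1(\xi)=T^1(\pi_r(f)\xi)$. $\mathcal{T}(E)$ is the universal $C^*$-algebra generated by a Toeplitz $E$-pair. For a locally compact space $X$, $\widetilde X=X\cup\{\infty\}$ is its one-point compactification ($\infty$ is isolated if $X$ is compact). Functions in $C_0(X)$ are regarded as continuous functions on $\widetilde X$ vanishing at $\infty$; elements of $C_d(E^1)$ (which lie in $C_0(E^1)$) are extended likewise. A factor map from $F$ to $E$ is a pair $m=(m^0,m^1)$ of continuous maps $m^0\colon\widetilde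 F^0\to\widetilde E^0$, $m^1\colon\widetilde F^1\to\widetilde E^1$ sending $\infty$ to $\infty$ such that: (i) for every $e\in F^1$ with $m^1(e)\in E^1$, $r_E(m^1(e))=m^0(r_F(e))$ and $d_E(m^1(e))=m^0(d_F(e))$; (ii) if $e'\in E^1$ and $v\in F^0$ satisfy $d_E(e')=m^0(v)$, then there is a unique $e\in F^1$ with $m^1(e)=e'$ and $d_F(e)=v$. (The maps $\mu^0,\mu^1$ are then well defined.) *)

theory Defs
  imports "HOL-Analysis.Analysis" "HOL-Algebra.Module"
begin

section \<open>C*-algebras\<close>

text \<open>
  C*-algebras are complex, associative and not assumed to be unital: the field \<open>one\<close>, inherited
  from the rings of HOL-Algebra, is never constrained. The zero algebra is allowed.
\<close>

record 'a cstar_alg = "(complex, 'a) module" +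
  star :: "'a \<Rightarrow> 'a"
  cnorm :: "'a \<Rightarrow> real"

locale cstar_algebra = abelian_group A for A :: "'a cstar_alg" (structure) +
  assumes smult_closed:
      "x \<in> carrier A \<Longrightarrow> a \<odot> x \<in> carrier A"
    and smult_add_left:
      "x \<in> carrier A \<Longrightarrow> (a + b) \<odot> x = a \<odot> x \<oplus> b \<odot> x"
    and smult_add_right:
      "\<lbrakk>x \<in> carrier A; y \<in> carrier A\<rbrakk> \<Longrightarrow> a \<odot> (x \<oplus> y) = a \<odot> x \<oplus> a \<odot> y"
    and smult_smult:
      "x \<in> carrier A \<Longrightarrow> a \<odot> (b \<odot> x) = (a * b) \<odot> x"
    and smult_one:
      "x \<in> carrier A \<Longrightarrow> 1 \<odot> x = x"
    and mult_closed:
      "\<lbrakk>x \<in> carrier A; y \<in> carrier A\<rbrakk> \<Longrightarrow> x \<otimes> y \<in> carrier A"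
    and mult_assoc:
      "\<lbrakk>x \<in> carrier A; y \<in> carrier A; z \<in> carrier A\<rbrakk> \<Longrightarrow> (x \<otimes> y) \<otimes> z = x \<otimes> (y \<otimes> z)"
    and mult_add_left:
      "\<lbrakk>x \<in> carrier A; y \<in> carrier A; z \<in> carrier A\<rbrakk> \<Longrightarrow> (x \<oplus> y) \<otimes> z = x \<otimes> z \<oplus> y \<otimes> z"
    and mult_add_right:
      "\<lbrakk>x \<in> carrier A; y \<in> carrier A; z \<in> carrier A\<rbrakk> \<Longrightarrow> x \<otimes> (y \<oplus> z) = x \<otimes> y \<oplus> x \<otimes> z"
    and mult_smult_left:
      "\<lbrakk>x \<in> carrier A; y \<in> carrier A\<rbrakk> \<Longrightarrow> (a \<odot> x) \<otimes> y = a \<odot> (x \<otimes> y)"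
    and mult_smult_right:
      "\<lbrakk>x \<in> carrier A; y \<in> carrier A\<rbrakk> \<Longrightarrow> x \<otimes> (a \<odot> y) = a \<odot> (x \<otimes> y)"
    and star_closed:
      "x \<in> carrier A \<Longrightarrow> star A x \<in> carrier A"
    and star_star:
      "x \<in> carrier A \<Longrightarrow> star A (star A x) = x"
    and star_add:
      "\<lbrakk>x \<in> carrier A; y \<in> carrier A\<rbrakk> \<Longrightarrow> star A (x \<oplus> y) = star A x \<oplus> star A y"
    and star_smult:
      "x \<in> carrier A \<Longrightarrow> star A (a \<odot> x) = cnj a \<odot> star A x"
    and star_mult:
      "\<lbrakk>x \<in> carrier A; y \<in> carrier A\<rbrakk> \<Longrightarrow> star A (x \<otimes> y) = star A y \<otimes> star A x"
    and cnorm_nonneg: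
      "x \<in> carrier A \<Longrightarrow> 0 \<le> cnorm A x"
    and cnorm_eq_0_iff:
      "x \<in> carrier A \<Longrightarrow> cnorm A x = 0 \<longleftrightarrow> x = \<zero>"
    and cnorm_triangle:
      "\<lbrakk>x \<in> carrier A; y \<in> carrier A\<rbrakk> \<Longrightarrow> cnorm A (x \<oplus> y) \<le> cnorm A x + cnorm A y"
    and cnorm_smult:
      "x \<in> carrier A \<Longrightarrow> cnorm A (a \<odot> x) = cmod a * cnorm A x"
    and cnorm_mult_le:
      "\<lbrakk>x \<in> carrier A; y \<in> carrier A\<rbrakk> \<Longrightarrow> cnorm A (x \<otimes> y) \<le> cnorm A x * cnorm A y"
    and cstar_identity:
      "x \<in> carrier A \<Longrightarrow> cnorm A (star A x \<otimes> x) = (cnorm A x)\<^sup>2"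
    and complete:
      "\<lbrakk>\<And>n. X n \<in> carrier A;
        \<forall>\<epsilon>>0. \<exists>N. \<forall>m\<ge>N. \<forall>n\<ge>N. cnorm A (X m \<ominus> X n) < \<epsilon>\<rbrakk>
       \<Longrightarrow> \<exists>x\<in>carrier A. (\<lambda>n::nat. cnorm A (X n \<ominus> x)) \<longlonglongrightarrow> 0"

text \<open>As usual, *-homomorphisms are purely algebraic; continuity is not part of the definition.\<close>

definition star_hom :: "'a cstar_alg \<Rightarrow> 'b cstar_alg \<Rightarrow> ('a \<Rightarrow> 'b) \<Rightarrow> bool" where
  "star_hom A B \<phi> \<longleftrightarrow>
     \<phi> \<in> carrier A \<rightarrow> carrier B \<and>
     (\<forall>x\<in>carrier A. \<forall>y\<in>carrier A. \<phi> (x \<oplus>\<^bsub>A\<^esub> y) = \<phi> x \<oplus>\<^bsub>B\<^esub> \<phi> y) \<and>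
     (\<forall>a. \<forall>x\<in>carrier A. \<phi> (a \<odot>\<^bsub>A\<^esub> x) = a \<odot>\<^bsub>B\<^esub> \<phi> x) \<and>
     (\<forall>x\<in>carrier A. \<forall>y\<in>carrier A. \<phi> (x \<otimes>\<^bsub>A\<^esub> y) = \<phi> x \<otimes>\<^bsub>B\<^esub> \<phi> y) \<and>
     (\<forall>x\<in>carrier A. \<phi> (star A x) = star B (\<phi> x))"

definition cstar_subalgebra :: "'a cstar_alg \<Rightarrow> 'a set \<Rightarrow> bool" where
  "cstar_subalgebra A S \<longleftrightarrow>
     S \<subseteq> carrier A \<and> \<zero>\<^bsub>A\<^esub> \<in> S \<and>
     (\<forall>x\<in>S. \<forall>y\<in>S. x \<oplus>\<^bsub>A\<^esub> y \<in> S) \<and>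
     (\<forall>a. \<forall>x\<in>S. a \<odot>\<^bsub>A\<^esub> x \<in> S) \<and>
     (\<forall>x\<in>S. \<forall>y\<in>S. x \<otimes>\<^bsub>A\<^esub> y \<in> S) \<and>
     (\<forall>x\<in>S. star A x \<in> S) \<and>
     (\<forall>X. \<forall>x\<in>carrier A. (\<forall>n. X n \<in> S) \<and> (\<lambda>n::nat. cnorm A (X n \<ominus>\<^bsub>A\<^esub> x)) \<longlonglongrightarrow> 0
        \<longrightarrow> x \<in> S)"

definition cstar_generated_by :: "'a cstar_alg \<Rightarrow> 'a set \<Rightarrow> bool" where
  "cstar_generated_by A G \<longleftrightarrow>
     G \<subseteq> carrier A \<and> (\<forall>S. cstar_subalgebra A S \<and> G \<subseteq> S \<longrightarrow> S = carrier A)"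

section \<open>The C*-algebra \<open>C\<^sub>0(X)\<close>\<close>

text \<open>
  A function on the space \<open>X\<close> is represented by the function on the whole type that is 0 off
  \<open>topspace X\<close>, so that equality of functions is equality on \<open>X\<close>.
\<close>

definition C0 :: "'x topology \<Rightarrow> ('x \<Rightarrow> complex) set" where
  "C0 X = {f. continuous_map X euclidean f \<and>
              (\<forall>\<epsilon>>0. compactin X {x \<in> topspace X. \<epsilon> \<le> cmod (f x)}) \<and>
              (\<forall>x. x \<notin> topspace X \<longrightarrow> f x = 0)}"

text \<open>
  The function \<open>one\<close> below belongs to the carrier only if \<open>X\<close> is compact. The supremum is that of
  \<open>|f|\<close> over \<open>X\<close>, since \<open>f\<close> vanishes off \<open>X\<close>; it makes sense also for empty \<open>X\<close>.
\<close>

definition C0_alg :: "'x topology \<Rightarrow> ('x \<Rightarrow> complex) cstar_alg" where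
  "C0_alg X =
     \<lparr>carrier = C0 X,
      mult = (\<lambda>f g x. f x * g x),
      one = (\<lambda>x. if x \<in> topspace X then 1 else 0),
      zero = (\<lambda>x. 0),
      add = (\<lambda>f g x. f x + g x),
      smult = (\<lambda>a f x. a * f x),
      star = (\<lambda>f x. cnj (f x)),
      cnorm = (\<lambda>f. SUP x. cmod (f x))\<rparr>"

section \<open>Topological graphs\<close>

record ('v, 'e) tgraph =
  verts :: "'v topology"
  edges :: "'e topology"
  dom :: "'e \<Rightarrow> 'v"
  ran :: "'e \<Rightarrow> 'v"

definition local_homeomorphism_map :: "'a topology \<Rightarrow> 'b topology \<Rightarrow> ('a \<Rightarrow> 'b) \<Rightarrow> bool" where
  "local_homeomorphism_map X Y f \<longleftrightarrow>
     (\<forall>x\<in>topspace X. \<exists>U. openin X U \<and> x \<in> U \<and> openin Y (f ` U) \<and>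
        homeomorphic_map (subtopology X U) (subtopology Y (f ` U)) f)"

definition topological_graph :: "('v, 'e) tgraph \<Rightarrow> bool" where
  "topological_graph E \<longleftrightarrow>
     locally_compact_space (verts E) \<and> Hausdorff_space (verts E) \<and>
     locally_compact_space (edges E) \<and> Hausdorff_space (edges E) \<and>
     local_homeomorphism_map (edges E) (verts E) (dom E) \<and>
     continuous_map (edges E) (verts E) (ran E)"

definition fiber :: "('v, 'e) tgraph \<Rightarrow> 'v \<Rightarrow> 'e set" where
  "fiber E v = {e \<in> topspace (edges E). dom E e = v}"

text \<open>For \<open>v\<close> outside the vertex space the fiber is empty and the inner product is 0.\<close>

definition Cd_inner ::
    "('v, 'e) tgraph \<Rightarrow> ('e \<Rightarrow> complex) \<Rightarrow> ('e \<Rightarrow> complex) \<Rightarrow> 'v \<Rightarrow> complex" where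
  "Cd_inner E \<xi> \<eta> v = (\<Sum>\<^sub>\<infinity>e\<in>fiber E v. cnj (\<xi> e) * \<eta> e)"

definition Cd :: "('v, 'e) tgraph \<Rightarrow> ('e \<Rightarrow> complex) set" where
  "Cd E = {\<xi>. continuous_map (edges E) euclidean \<xi> \<and>
              (\<forall>e. e \<notin> topspace (edges E) \<longrightarrow> \<xi> e = 0) \<and>
              (\<forall>v\<in>topspace (verts E). (\<lambda>e. (cmod (\<xi> e))\<^sup>2) summable_on fiber E v) \<and>
              Cd_inner E \<xi> \<xi> \<in> C0 (verts E)}"

definition left_action ::
    "('v, 'e) tgraph \<Rightarrow> ('v \<Rightarrow> complex) \<Rightarrow> ('e \<Rightarrow> complex) \<Rightarrow> 'e \<Rightarrow> complex" where
  "left_action E f \<xi> e = f (ran E e) * \<xi> e"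

section \<open>Toeplitz pairs\<close>

definition toeplitz_pair ::
    "('v, 'e) tgraph \<Rightarrow> 'a cstar_alg \<Rightarrow> (('v \<Rightarrow> complex) \<Rightarrow> 'a) \<Rightarrow> (('e \<Rightarrow> complex) \<Rightarrow> 'a) \<Rightarrow> bool"
where
  "toeplitz_pair E A T0 T1 \<longleftrightarrow>
     star_hom (C0_alg (verts E)) A T0 \<and>
     T1 \<in> Cd E \<rightarrow> carrier A \<and>
     (\<forall>\<xi>\<in>Cd E. \<forall>\<eta>\<in>Cd E. T1 (\<lambda>e. \<xi> e + \<eta> e) = T1 \<xi> \<oplus>\<^bsub>A\<^esub> T1 \<eta>) \<and>
     (\<forall>a. \<forall>\<xi>\<in>Cd E. T1 (\<lambda>e. a * \<xi> e) = a \<odot>\<^bsub>A\<^esub> T1 \<xi>) \<and>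
     (\<forall>\<xi>\<in>Cd E. \<forall>\<eta>\<in>Cd E. star A (T1 \<xi>) \<otimes>\<^bsub>A\<^esub> T1 \<eta> = T0 (Cd_inner E \<xi> \<eta>)) \<and>
     (\<forall>f\<in>C0 (verts E). \<forall>\<xi>\<in>Cd E. T0 f \<otimes>\<^bsub>A\<^esub> T1 \<xi> = T1 (left_action E f \<xi>))"

text \<open>
  \<open>A\<close> together with \<open>(T0, T1)\<close> is the universal C*-algebra generated by a Toeplitz \<open>E\<close>-pair.
  HOL cannot quantify over types inside a formula, so the type \<open>'b\<close> carrying the C*-algebras
  against which universality is tested is a parameter (compare a universe level). Universality in
  the usual sense is universality for every \<open>'b\<close>. Uniqueness of \<open>\<phi>\<close> is not demanded: it is a
  consequence of generation.
\<close>

definition universal_toeplitz_pair ::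
    "'b itself \<Rightarrow> ('v, 'e) tgraph \<Rightarrow> 'a cstar_alg \<Rightarrow>
     (('v \<Rightarrow> complex) \<Rightarrow> 'a) \<Rightarrow> (('e \<Rightarrow> complex) \<Rightarrow> 'a) \<Rightarrow> bool" where
  "universal_toeplitz_pair (_ :: 'b itself) E A T0 T1 \<longleftrightarrow>
     cstar_algebra A \<and>
     toeplitz_pair E A T0 T1 \<and>
     cstar_generated_by A (T0 ` C0 (verts E) \<union> T1 ` Cd E) \<and>
     (\<forall>(B :: 'b cstar_alg) S0 S1. cstar_algebra B \<and> toeplitz_pair E B S0 S1 \<longrightarrow>
        (\<exists>\<phi>. star_hom A B \<phi> \<and>
             (\<forall>f\<in>C0 (verts E). \<phi> (T0 f) = S0 f) \<and>
             (\<forall>\<xi>\<in>Cd E. \<phi> (T1 \<xi>) = S1 \<xi>)))"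

section \<open>Factor maps\<close>

text \<open>
  The one-point compactification of \<open>X\<close> lives on the option type, with \<open>None\<close> as the point at
  infinity.
\<close>

definition factor_map ::
    "('w, 'f) tgraph \<Rightarrow> ('v, 'e) tgraph \<Rightarrow> ('w option \<Rightarrow> 'v option) \<Rightarrow> ('f option \<Rightarrow> 'e option) \<Rightarrow> bool"
where
  "factor_map F E m0 m1 \<longleftrightarrow>
     continuous_map (Alexandroff_compactification (verts F)) (Alexandroff_compactification (verts E)) m0 \<and>
     continuous_map (Alexandroff_compactification (edges F)) (Alexandroff_compactification (edges E)) m1 \<and>
     m0 None = None \<and> m1 None = None \<and>
     (\<forall>e\<in>topspace (edges F). \<forall>e'\<in>topspace (edges E). m1 (Some e) = Some e' \<longrightarrow>
        Some (ran E e') = m0 (Some (ran F e)) \<and> Some (dom E e') = m0 (Some (dom F e))) \<and>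
     (\<forall>e'\<in>topspace (edges E). \<forall>v\<in>topspace (verts F). Some (dom E e') = m0 (Some v) \<longrightarrow>
        (\<exists>!e. e \<in> topspace (edges F) \<and> m1 (Some e) = Some e' \<and> dom F e = v))"

text \<open>\<open>f \<circ> m\<close> on \<open>X\<close>, where \<open>f\<close> is extended by 0 at infinity.\<close>

definition pullback :: "'x topology \<Rightarrow> ('x option \<Rightarrow> 'y option) \<Rightarrow> ('y \<Rightarrow> complex) \<Rightarrow> 'x \<Rightarrow> complex" where
  "pullback X m f x =
     (if x \<in> topspace X then (case m (Some x) of None \<Rightarrow> 0 | Some y \<Rightarrow> f y) else 0)"

end

theory Submission
  imports Defs
begin

text \<open>
  Existence: the bijections of fibers in the definition of a factor map make
  \<open>(T\<^sub>F\<^sup>0 \<circ> \<mu>\<^sup>0, T\<^sub>F\<^sup>1 \<circ> \<mu>\<^sup>1)\<close> a Toeplitz \<open>E\<close>-pair, to which the universal property applies. The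
  delicate point is that \<open>\<mu>\<^sup>1\<close> is well defined, for which one needs \<open>C\<^sub>d(E\<^sup>1) \<subseteq> C\<^sub>0(E\<^sup>1)\<close>.

  Uniqueness: *-homomorphisms between C*-algebras are continuous, so they are determined by their
  values on generators. Continuity is obtained without spectral theory: if \<open>a\<close> is self-adjoint and
  \<open>\<parallel>a\<parallel> \<le> 1/2\<close>, then \<open>1 - a\<^sup>2\<close> has a self-adjoint square root \<open>b\<close> commuting with \<open>a\<close>, the elements
  \<open>a \<plusminus> i b\<close> of the unitization are unitary, and so are their images, whose mean is the image of \<open>a\<close>.
\<close>

section \<open>Continuity of *-homomorphisms\<close>

context cstar_algebra
begin

section \<open>Scalars, norm and involution in a C*-algebra without unit\<close>

lemma smult_0_left: "x \<in> carrier A \<Longrightarrow> 0 \<odot> x = \<zero>"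
  using smult_add_left[of x 0 0] smult_closed[of x 0] by (simp add: add.l_cancel_one')

lemma minus_eq_smult: "x \<in> carrier A \<Longrightarrow> \<ominus> x = (-1) \<odot> x"
  using smult_add_left[of x "-1" 1]
  by (intro minus_equality) (simp_all add: smult_one smult_closed smult_0_left)

lemma diff_eq_smult: "\<lbrakk>x \<in> carrier A; y \<in> carrier A\<rbrakk> \<Longrightarrow> x \<ominus> y = x \<oplus> (-1) \<odot> y"
  by (simp add: minus_eq minus_eq_smult)

lemma cnorm_diff_commute:
  assumes "x \<in> carrier A" "y \<in> carrier A"
  shows "cnorm A (x \<ominus> y) = cnorm A (y \<ominus> x)"
proof -
  have "y \<ominus> x = (-1) \<odot> (x \<ominus> y)"
    using assms by (simp add: diff_eq_smult smult_closed smult_add_right smult_smult smult_one a_comm)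
  then show ?thesis
    using assms by (simp add: cnorm_smult)
qed

lemma cnorm_diff_triangle:
  assumes "x \<in> carrier A" "y \<in> carrier A" "z \<in> carrier A"
  shows "cnorm A (x \<ominus> z) \<le> cnorm A (x \<ominus> y) + cnorm A (y \<ominus> z)"
proof -
  have "x \<ominus> z = (x \<ominus> y) \<oplus> (y \<ominus> z)"
    using assms by (simp add: minus_eq a_assoc r_neg1)
  then show ?thesis
    using assms by (simp add: cnorm_triangle)
qed

lemma cnorm_diff_eq_0_iff:
  "\<lbrakk>x \<in> carrier A; y \<in> carrier A\<rbrakk> \<Longrightarrow> cnorm A (x \<ominus> y) = 0 \<longleftrightarrow> x = y"
  using cnorm_eq_0_iff[of "x \<ominus> y"] by (auto simp: minus_eq r_neg dest: minus_equality)

text \<open>The C*-identity and submultiplicativity bound the square of the norm of \<open>y\<close>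
  by the product of the norms of \<open>star A y\<close> and \<open>y\<close>. Cancelling gives one
  inequality, and replacing \<open>y\<close> by its adjoint gives the other.\<close>

lemma cnorm_star:
  assumes "x \<in> carrier A"
  shows "cnorm A (star A x) = cnorm A x"
proof -
  have le: "cnorm A y \<le> cnorm A (star A y)" if y: "y \<in> carrier A" for y
  proof (cases "cnorm A y = 0")
    case True
    then show ?thesis using y by (simp add: cnorm_nonneg star_closed)
  next
    case False
    have "cnorm A y * cnorm A y \<le> cnorm A (star A y) * cnorm A y"
      using cnorm_mult_le[of "star A y" y] y by (simp add: cstar_identity power2_eq_square star_closed)
    with False y show ?thesis
      using cnorm_nonneg[of y] by (simp add: mult_le_cancel_right)
  qed
  show ?thesis
    using le[OF assms] le[of "star A x"] assms by (simp add: star_closed star_star)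
qed

text \<open>
  The hypothesis says \<open>s\<^sup>2 + (1 - h)\<^sup>2 = 1\<close>, so \<open>s + c(1 - h)\<close> is unitary in the unitization;
  here it acts on \<open>A\<close> by left multiplication.
\<close>
lemma cnorm_unitary_mult:
  assumes carr: "s \<in> carrier A" "h \<in> carrier A" "y \<in> carrier A"
    and sa: "star A s = s" "star A h = h"
    and comm: "s \<otimes> h = h \<otimes> s"
    and eq: "s \<otimes> s \<oplus> h \<otimes> h = h \<oplus> h"
    and c: "cnj c = - c" "c * c = - 1"
  shows "cnorm A (s \<otimes> y \<oplus> c \<odot> (y \<oplus> (-1) \<odot> (h \<otimes> y))) = cnorm A y"
proof -
  define Y where "Y = star A y"
  have Y: "Y \<in> carrier A" using carr by (simp add: Y_def star_closed)
  note cl = carr Y smult_closed mult_closed a_closed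
  define z where "z = s \<otimes> y \<oplus> c \<odot> (y \<oplus> (-1) \<odot> (h \<otimes> y))"
  have z: "z \<in> carrier A" by (simp add: z_def cl)
  have hs: "h \<otimes> (s \<otimes> y) = s \<otimes> (h \<otimes> y)"
    using comm carr by (metis mult_assoc)
  have P: "s \<otimes> (s \<otimes> y) \<oplus> h \<otimes> (h \<otimes> y) = h \<otimes> y \<oplus> h \<otimes> y"
    using arg_cong[OF eq, of "\<lambda>x. x \<otimes> y"] by (simp add: cl mult_add_left mult_assoc)
  \<comment> \<open>Since \<open>s\<close> and \<open>h\<close> commute, every term of
    \<open>star A z \<otimes> z\<close> is a scalar multiple of one of these six words. Naming them
    turns the computation into additive arithmetic.\<close>
  define Q R T V W X where QR: "Q = Y \<otimes> (s \<otimes> y)" "R = Y \<otimes> (s \<otimes> (h \<otimes> y))" "T = Y \<otimes> y"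
    "V = Y \<otimes> (h \<otimes> y)" "W = Y \<otimes> (h \<otimes> (h \<otimes> y))" "X = Y \<otimes> (s \<otimes> (s \<otimes> y))"
  have QRc: "Q \<in> carrier A" "R \<in> carrier A" "T \<in> carrier A" "V \<in> carrier A" "W \<in> carrier A"
    "X \<in> carrier A" by (simp_all add: QR cl)
  have X: "X \<oplus> W = V \<oplus> V"
    using arg_cong[OF P, of "\<lambda>x. Y \<otimes> x"] by (simp add: QR cl mult_add_right)
  have zs: "star A z = Y \<otimes> s \<oplus> (- c) \<odot> (Y \<oplus> (-1) \<odot> (Y \<otimes> h))"
    using carr by (simp add: z_def Y_def cl star_add star_mult star_smult sa c star_closed)
  have col: "a \<odot> x \<oplus> (b \<odot> x \<oplus> u) = (a + b) \<odot> x \<oplus> u"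
     if "x \<in> carrier A" "u \<in> carrier A" for a b x u
    using that by (simp add: smult_add_left a_assoc smult_closed)
  \<comment> \<open>Because \<open>c * c = -1\<close>, the terms without a factor \<open>c\<close>
    are \<open>X + W + T - 2V\<close>, and \<open>X + W = 2V\<close> by the hypothesis on
    \<open>s\<close> and \<open>h\<close>. The terms in \<open>Q\<close> and \<open>R\<close> cancel
    in pairs.\<close>
  have "star A z \<otimes> z = (X \<oplus> W) \<oplus> (T \<oplus> ((-1) \<odot> V \<oplus> ((-1) \<odot> V \<oplus>
      (c \<odot> Q \<oplus> ((- c) \<odot> Q \<oplus> ((- c) \<odot> R \<oplus> c \<odot> R))))))"
    unfolding zs unfolding z_def
    using QRc
    by (simp add: cl mult_add_left mult_add_right mult_smult_left mult_smult_right mult_assoc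
          smult_add_right smult_smult hs c QR[symmetric] a_ac smult_one)
  also have "\<dots> = T"
  proof -
    have "c \<odot> Q \<oplus> ((- c) \<odot> Q \<oplus> ((- c) \<odot> R \<oplus> c \<odot> R)) = \<zero>"
      using QRc by (simp add: col smult_add_left[symmetric] smult_closed smult_0_left)
    then show ?thesis
      using QRc by (simp add: X minus_eq_smult[symmetric])
         (simp add: a_assoc a_lcomm[of _ T] r_neg r_neg2)
  qed
  finally have "star A z \<otimes> z = star A y \<otimes> y" by (simp add: QR Y_def)
  then have "(cnorm A z)\<^sup>2 = (cnorm A y)\<^sup>2"
    using z carr by (metis cstar_identity)
  then show ?thesis
    using z carr by (simp add: z_def cnorm_nonneg)
qed

section \<open>Differences, limits and a square root by fixed point iteration\<close>

lemma smult_diff: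
  "\<lbrakk>x \<in> carrier A; y \<in> carrier A\<rbrakk> \<Longrightarrow> a \<odot> (x \<ominus> y) = a \<odot> x \<ominus> a \<odot> y"
  by (simp add: diff_eq_smult smult_add_right smult_smult smult_closed)

lemma mult_diff_right:
  "\<lbrakk>x \<in> carrier A; y \<in> carrier A; z \<in> carrier A\<rbrakk> \<Longrightarrow> x \<otimes> (y \<ominus> z) = x \<otimes> y \<ominus> x \<otimes> z"
  by (simp add: diff_eq_smult mult_add_right mult_smult_right smult_closed mult_closed)

lemma mult_diff_left:
  "\<lbrakk>x \<in> carrier A; y \<in> carrier A; z \<in> carrier A\<rbrakk> \<Longrightarrow> (y \<ominus> z) \<otimes> x = y \<otimes> x \<ominus> z \<otimes> x"
  by (simp add: diff_eq_smult mult_add_left mult_smult_left smult_closed mult_closed)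

lemma star_diff:
  "\<lbrakk>x \<in> carrier A; y \<in> carrier A\<rbrakk> \<Longrightarrow> star A (x \<ominus> y) = star A x \<ominus> star A y"
  by (simp add: diff_eq_smult star_add star_smult smult_closed star_closed)

text \<open>Used to pass equations to the limit: both sides are compared with the same sequence
  \<open>w\<close> through a common null sequence \<open>d\<close>.\<close>

lemma limit_unique:
  assumes "u \<in> carrier A" "v \<in> carrier A" "\<And>n. w n \<in> carrier A"
    and d: "d \<longlonglongrightarrow> 0"
    and "\<And>n::nat. cnorm A (u \<ominus> w n) \<le> d n" "\<And>n. cnorm A (v \<ominus> w n) \<le> d n"
  shows "u = v"
proof -
  have "cnorm A (u \<ominus> v) \<le> d n + d n" for n
    using cnorm_diff_triangle[of u "w n" v] assms(1-3) assms(5,6)[of n]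
    by (simp add: cnorm_diff_commute[of "w n" v])
  moreover have "(\<lambda>n. d n + d n) \<longlonglongrightarrow> 0"
    using tendsto_add[OF d d] by simp
  ultimately have "cnorm A (u \<ominus> v) \<le> 0"
    by (meson LIMSEQ_le_const)
  then have "cnorm A (u \<ominus> v) = 0"
    using assms(1,2) by (simp add: antisym cnorm_nonneg)
  then show ?thesis
    using assms(1,2) by (simp add: cnorm_diff_eq_0_iff)
qed

text \<open>
  The element \<open>h = 1 - (1 - a\<^sup>2)\<^sup>1\<^sup>/\<^sup>2\<close> is the fixed point of the contraction \<open>x \<mapsto> (a\<^sup>2 + x\<^sup>2) / 2\<close>.
\<close>
lemma exists_one_minus_sqrt:
  assumes a: "a \<in> carrier A" "star A a = a" "cnorm A a \<le> 1/2"
  obtains h where "h \<in> carrier A" "star A h = h" "a \<otimes> h = h \<otimes> a" "a \<otimes> a \<oplus> h \<otimes> h = h \<oplus> h"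
proof -
  \<comment> \<open>Self-adjointness and commutation with \<open>a\<close> are built into the space,
    so the fixed point has both. The radius 1/2 lets \<open>f\<close> map \<open>M\<close> into
    itself with Lipschitz constant 1/2.\<close>
  define M where "M = {x \<in> carrier A. star A x = x \<and> a \<otimes> x = x \<otimes> a \<and> cnorm A x \<le> 1/2}"
  \<comment> \<open>\<open>Metric_space\<close> asks for nonnegativity and symmetry on the whole
    type, hence the default value 0 off the carrier.\<close>
  define d where "d x y = (if x \<in> carrier A \<and> y \<in> carrier A then cnorm A (x \<ominus> y) else 0)" for x y
  define f where "f x = (1/2) \<odot> (a \<otimes> a \<oplus> x \<otimes> x)" for x
  have MA: "x \<in> carrier A" if "x \<in> M" for x using that by (simp add: M_def)
  interpret M: Metric_space M d
    by unfold_locales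
       (auto simp: d_def MA cnorm_nonneg cnorm_diff_commute cnorm_diff_eq_0_iff cnorm_diff_triangle)
  have "M.mcomplete"
    unfolding M.mcomplete_def
  proof (intro allI impI)
    fix X assume X: "M.MCauchy X"
    then have XM: "X n \<in> M" for n by (auto simp: M.MCauchy_def)
    then have XA: "X n \<in> carrier A" for n by (simp add: MA)
    have "\<forall>\<epsilon>>0. \<exists>N. \<forall>m\<ge>N. \<forall>n\<ge>N. cnorm A (X m \<ominus> X n) < \<epsilon>"
      using X XA unfolding M.MCauchy_def d_def by simp
    with XA obtain x where x: "x \<in> carrier A" and "(\<lambda>n. cnorm A (X n \<ominus> x)) \<longlonglongrightarrow> 0"
      using complete by blast
    then have lim: "(\<lambda>n. cnorm A (x \<ominus> X n)) \<longlonglongrightarrow> 0"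
      using XA by (simp add: cnorm_diff_commute)
    \<comment> \<open>The limit exists in \<open>A\<close>. It lies in \<open>M\<close> because each
      condition defining \<open>M\<close> is closed.\<close>
    have "star A x = x"
    proof (rule limit_unique[OF _ _ _ lim])
      show "cnorm A (star A x \<ominus> X n) \<le> cnorm A (x \<ominus> X n)" for n
        using XM[of n] x XA cnorm_star[of "x \<ominus> X n"] by (simp add: M_def star_diff)
    qed (use x XA star_closed in auto)
    moreover have "a \<otimes> x = x \<otimes> a"
    proof (rule limit_unique[where w = "\<lambda>n. a \<otimes> X n" and d = "\<lambda>n. cnorm A a * cnorm A (x \<ominus> X n)"])
      show "(\<lambda>n. cnorm A a * cnorm A (x \<ominus> X n)) \<longlonglongrightarrow> 0"
        using tendsto_mult_left[OF lim, of "cnorm A a"] by simp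
      show "cnorm A (a \<otimes> x \<ominus> a \<otimes> X n) \<le> cnorm A a * cnorm A (x \<ominus> X n)" for n
        using cnorm_mult_le[of a "x \<ominus> X n"] x XA[of n] a by (simp add: mult_diff_right)
      show "cnorm A (x \<otimes> a \<ominus> a \<otimes> X n) \<le> cnorm A a * cnorm A (x \<ominus> X n)" for n
        using cnorm_mult_le[of "x \<ominus> X n" a] x XA[of n] XM[of n] a
        by (simp add: mult_diff_left M_def mult.commute)
    qed (use x XA a mult_closed in auto)
    moreover have "cnorm A x \<le> 1/2"
    proof -
      have "cnorm A x \<le> cnorm A (x \<ominus> X n) + 1/2" for n
      proof -
        have "x = (x \<ominus> X n) \<oplus> X n" using x XA[of n] by (simp add: minus_eq a_assoc l_neg)
        then have "cnorm A x \<le> cnorm A (x \<ominus> X n) + cnorm A (X n)"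
          using cnorm_triangle[of "x \<ominus> X n" "X n"] x XA[of n] by simp
        then show ?thesis using XM[of n] by (simp add: M_def)
      qed
      moreover have "(\<lambda>n. cnorm A (x \<ominus> X n) + 1/2) \<longlonglongrightarrow> 1/2"
        using tendsto_add[OF lim tendsto_const[of "1/2"]] by simp
      ultimately show ?thesis by (meson LIMSEQ_le_const)
    qed
    ultimately have "x \<in> M" using x by (simp add: M_def)
    moreover have "(\<lambda>n. d (X n) x) \<longlonglongrightarrow> 0"
      using lim x XA by (simp add: d_def cnorm_diff_commute)
    ultimately show "\<exists>x. limitin M.mtopology X x sequentially"
      using XM by (auto simp: M.limitin_metric_dist_null)
  qed
  moreover have "M \<noteq> {}"
  proof -
    have "star A \<zero> = \<zero>" "a \<otimes> \<zero> = \<zero>" "\<zero> \<otimes> a = \<zero>"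
      using star_smult[of \<zero> 0] mult_smult_right[of a \<zero> 0] mult_smult_left[of \<zero> a 0] a
      by (simp_all add: smult_0_left star_closed mult_closed)
    then have "\<zero> \<in> M"
      using cnorm_eq_0_iff[of \<zero>] by (simp add: M_def)
    then show ?thesis by blast
  qed
  moreover have "f \<in> M \<rightarrow> M"
  proof
    fix x assume x: "x \<in> M"
    have "cnorm A (a \<otimes> a) \<le> 1/4" "cnorm A (x \<otimes> x) \<le> 1/4"
      using a x cnorm_mult_le[of a a] cnorm_mult_le[of x x] cnorm_nonneg[of a] cnorm_nonneg[of x]
        mult_mono[of "cnorm A a" "1/2" "cnorm A a" "1/2"] mult_mono[of "cnorm A x" "1/2" "cnorm A x" "1/2"]
      by (auto simp: M_def)
    then have "cnorm A (f x) \<le> 1/2"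
      using cnorm_triangle[of "a \<otimes> a" "x \<otimes> x"] a x by (simp add: f_def M_def cnorm_smult mult_closed)
    moreover have "a \<otimes> (x \<otimes> x) = x \<otimes> x \<otimes> a"
    proof -
      have c: "x \<in> carrier A" "a \<otimes> x = x \<otimes> a"
        using x by (simp_all add: M_def)
      have "a \<otimes> (x \<otimes> x) = (x \<otimes> a) \<otimes> x"
        using a c by (simp add: mult_assoc[symmetric])
      also have "\<dots> = x \<otimes> (x \<otimes> a)"
        using a c by (simp add: mult_assoc)
      finally show ?thesis
        using a c by (simp add: mult_assoc)
    qed
    ultimately show "f x \<in> M"
      using a x by (simp add: f_def M_def star_smult star_add star_mult smult_closed mult_closed
        mult_smult_left mult_smult_right mult_add_left mult_add_right mult_assoc)
  qed
  moreover have "d (f x) (f y) \<le> 1/2 * d x y" if "x \<in> M" "y \<in> M" for x y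
  proof -
    have xy: "x \<in> carrier A" "y \<in> carrier A" "cnorm A x \<le> 1/2" "cnorm A y \<le> 1/2"
      using that by (simp_all add: M_def)
    have "f x \<ominus> f y = (1/2) \<odot> (x \<otimes> x \<ominus> y \<otimes> y)"
    proof -
      have "a \<otimes> a \<oplus> x \<otimes> x \<ominus> (a \<otimes> a \<oplus> y \<otimes> y) = x \<otimes> x \<ominus> y \<otimes> y"
        using a xy by (simp add: minus_eq minus_add mult_closed a_assoc a_lcomm[of "x \<otimes> x"] r_neg2)
      then show ?thesis
        using a xy smult_diff[of "a \<otimes> a \<oplus> x \<otimes> x" "a \<otimes> a \<oplus> y \<otimes> y" "1/2"]
        by (simp add: f_def mult_closed)
    qed
    \<comment> \<open>This splitting is valid even if \<open>x\<close> and \<open>y\<close> do not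
      commute.\<close>
    also have "x \<otimes> x \<ominus> y \<otimes> y = x \<otimes> (x \<ominus> y) \<oplus> (x \<ominus> y) \<otimes> y"
      using xy by (simp add: mult_diff_left mult_diff_right mult_closed)
         (simp add: mult_closed minus_eq a_assoc r_neg1)
    finally have "cnorm A (f x \<ominus> f y) \<le> 1/2 * (cnorm A (x \<otimes> (x \<ominus> y)) + cnorm A ((x \<ominus> y) \<otimes> y))"
      using cnorm_triangle[of "x \<otimes> (x \<ominus> y)" "(x \<ominus> y) \<otimes> y"] xy
      by (simp add: cnorm_smult mult_closed)
    also have "\<dots> \<le> 1/2 * cnorm A (x \<ominus> y)"
      using cnorm_mult_le[of x "x \<ominus> y"] cnorm_mult_le[of "x \<ominus> y" y] xy cnorm_nonneg[of "x \<ominus> y"]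
        mult_right_mono[of "cnorm A x" "1/2" "cnorm A (x \<ominus> y)"]
        mult_left_mono[of "cnorm A y" "1/2" "cnorm A (x \<ominus> y)"]
      by simp
    finally show ?thesis
      using xy a by (simp add: d_def f_def smult_closed mult_closed)
  qed
  moreover have "(1/2 :: real) < 1" by simp
  ultimately obtain h where h: "h \<in> M" "f h = h"
    using M.Banach_fixedpoint_thm[of f "1/2"] by metis
  have "h \<oplus> h = (1/2 + 1/2) \<odot> (a \<otimes> a \<oplus> h \<otimes> h)"
    using h a smult_add_left[of "a \<otimes> a \<oplus> h \<otimes> h" "1/2" "1/2"] by (simp add: f_def M_def mult_closed)
  then have "h \<oplus> h = a \<otimes> a \<oplus> h \<otimes> h"
    using h a by (simp add: M_def smult_one mult_closed)
  then show ?thesis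
    using h by (intro that[of h]) (simp_all add: M_def)
qed

end

section \<open>Boundedness of *-homomorphisms and agreement on generators\<close>

lemma star_hom_diff:
  assumes "cstar_algebra A" "cstar_algebra B" "star_hom A B \<phi>" "x \<in> carrier A" "y \<in> carrier A"
  shows "\<phi> (x \<ominus>\<^bsub>A\<^esub> y) = \<phi> x \<ominus>\<^bsub>B\<^esub> \<phi> y"
proof -
  interpret A: cstar_algebra A by fact
  interpret B: cstar_algebra B by fact
  show ?thesis
    using assms(3-5) by (simp add: A.diff_eq_smult B.diff_eq_smult star_hom_def Pi_iff A.smult_closed)
qed

text \<open>The relations between \<open>a\<close> and \<open>h\<close> are algebraic, so they
  survive under \<open>\<phi>\<close>. The two unitaries built from the images are applied to
  \<open>s = \<phi> a\<close> itself; the mean of the results is \<open>s \<otimes> s\<close>, so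
  the square of the norm of \<open>s\<close> is at most that norm.\<close>

lemma star_hom_self_adjoint_bound:
  assumes "cstar_algebra A" "cstar_algebra B" and \<phi>: "star_hom A B \<phi>"
    and a: "a \<in> carrier A" "star A a = a" "cnorm A a \<le> 1/2"
  shows "cnorm B (\<phi> a) \<le> 1"
proof -
  interpret A: cstar_algebra A by fact
  interpret B: cstar_algebra B by fact
  obtain h where h: "h \<in> carrier A" "star A h = h" "a \<otimes>\<^bsub>A\<^esub> h = h \<otimes>\<^bsub>A\<^esub> a"
    "a \<otimes>\<^bsub>A\<^esub> a \<oplus>\<^bsub>A\<^esub> h \<otimes>\<^bsub>A\<^esub> h = h \<oplus>\<^bsub>A\<^esub> h"
    using A.exists_one_minus_sqrt[OF a] by metis
  define s k where "s = \<phi> a" and "k = \<phi> h"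
  have s: "s \<in> carrier B" "star B s = s" and k: "k \<in> carrier B" "star B k = k"
    using \<phi> a h unfolding s_def k_def star_hom_def by (auto simp: Pi_iff)
  have sk: "s \<otimes>\<^bsub>B\<^esub> k = k \<otimes>\<^bsub>B\<^esub> s"
    using \<phi> a h unfolding s_def k_def star_hom_def by metis
  have eq: "s \<otimes>\<^bsub>B\<^esub> s \<oplus>\<^bsub>B\<^esub> k \<otimes>\<^bsub>B\<^esub> k = k \<oplus>\<^bsub>B\<^esub> k"
    using \<phi> a h A.mult_closed unfolding s_def k_def star_hom_def by metis
  \<comment> \<open>\<open>w\<close> plays the role of \<open>(1 - k) s\<close>, so
    \<open>s \<otimes> s\<close> plus \<open>c\<close> times \<open>w\<close> is the unitary
    \<open>s + c(1 - k)\<close> applied to \<open>s\<close>.\<close>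
  define w where "w = s \<oplus>\<^bsub>B\<^esub> (-1) \<odot>\<^bsub>B\<^esub> (k \<otimes>\<^bsub>B\<^esub> s)"
  have w: "w \<in> carrier B" using s k by (simp add: w_def B.mult_closed B.smult_closed)
  have n: "cnorm B (s \<otimes>\<^bsub>B\<^esub> s \<oplus>\<^bsub>B\<^esub> c \<odot>\<^bsub>B\<^esub> w) = cnorm B s" if "c = \<i> \<or> c = - \<i>" for c
    unfolding w_def by (rule B.cnorm_unitary_mult) (use s k sk eq that in auto)
  have ss: "s \<otimes>\<^bsub>B\<^esub> s \<in> carrier B" using s by (simp add: B.mult_closed)
  have "2 \<odot>\<^bsub>B\<^esub> (s \<otimes>\<^bsub>B\<^esub> s) =
      (s \<otimes>\<^bsub>B\<^esub> s \<oplus>\<^bsub>B\<^esub> \<i> \<odot>\<^bsub>B\<^esub> w) \<oplus>\<^bsub>B\<^esub> (s \<otimes>\<^bsub>B\<^esub> s \<oplus>\<^bsub>B\<^esub> (- \<i>) \<odot>\<^bsub>B\<^esub> w)"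
  proof -
    have "\<i> \<odot>\<^bsub>B\<^esub> w \<oplus>\<^bsub>B\<^esub> (- \<i>) \<odot>\<^bsub>B\<^esub> w = \<zero>\<^bsub>B\<^esub>"
      using w by (simp add: B.smult_add_left[symmetric] B.smult_0_left)
    moreover have "2 \<odot>\<^bsub>B\<^esub> (s \<otimes>\<^bsub>B\<^esub> s) = s \<otimes>\<^bsub>B\<^esub> s \<oplus>\<^bsub>B\<^esub> s \<otimes>\<^bsub>B\<^esub> s"
      using B.smult_add_left[OF ss, of 1 1] ss by (simp add: B.smult_one)
    ultimately show ?thesis
      using w ss by (simp add: B.a_assoc B.smult_closed B.a_lcomm[of "\<i> \<odot>\<^bsub>B\<^esub> w"])
  qed
  then have "2 * cnorm B (s \<otimes>\<^bsub>B\<^esub> s) \<le> 2 * cnorm B s"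
    using B.cnorm_triangle[of "s \<otimes>\<^bsub>B\<^esub> s \<oplus>\<^bsub>B\<^esub> \<i> \<odot>\<^bsub>B\<^esub> w" "s \<otimes>\<^bsub>B\<^esub> s \<oplus>\<^bsub>B\<^esub> (- \<i>) \<odot>\<^bsub>B\<^esub> w"] n
      B.cnorm_smult[OF ss, of 2] w ss by (simp add: B.smult_closed)
  then have "cnorm B s * cnorm B s \<le> 1 * cnorm B s"
    using B.cstar_identity[of s] s by (simp add: power2_eq_square)
  then show ?thesis
    using B.cnorm_nonneg[of s] s mult_right_le_imp_le[of "cnorm B s" "cnorm B s" 1] unfolding s_def[symmetric]
    by force
qed

text \<open>The sharp constant is 1, but any bound gives continuity.\<close>
lemma star_hom_bounded:
  assumes A: "cstar_algebra A" and B: "cstar_algebra B" and \<phi>: "star_hom A B \<phi>" and x: "x \<in> carrier A"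
  shows "cnorm B (\<phi> x) \<le> 2 * cnorm A x"
proof -
  interpret A: cstar_algebra A by fact
  interpret B: cstar_algebra B by fact
  \<comment> \<open>By the C*-identity, the self-adjoint case for
    \<open>star A y \<otimes> y\<close> controls the image of an arbitrary \<open>y\<close>.\<close>
  have unit: "cnorm B (\<phi> y) \<le> 1" if y: "y \<in> carrier A" "cnorm A y \<le> 1/2" for y
  proof -
    have "(cnorm A y)\<^sup>2 \<le> (1/2)\<^sup>2"
      using y A.cnorm_nonneg by (intro power_mono) auto
    then have "cnorm A (star A y \<otimes>\<^bsub>A\<^esub> y) \<le> 1/2"
      using y by (simp add: A.cstar_identity power2_eq_square)
    then have "cnorm B (\<phi> (star A y \<otimes>\<^bsub>A\<^esub> y)) \<le> 1"
      using y by (intro star_hom_self_adjoint_bound[OF A B \<phi>])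
        (simp_all add: A.star_mult A.star_star A.star_closed A.mult_closed)
    moreover have "\<phi> (star A y \<otimes>\<^bsub>A\<^esub> y) = star B (\<phi> y) \<otimes>\<^bsub>B\<^esub> \<phi> y" "\<phi> y \<in> carrier B"
      using \<phi> y by (auto simp: star_hom_def Pi_iff A.star_closed)
    ultimately have "(cnorm B (\<phi> y))\<^sup>2 \<le> 1\<^sup>2"
      by (simp add: B.cstar_identity)
    then show ?thesis
      by (rule power2_le_imp_le) simp
  qed
  have \<phi>x: "\<phi> x \<in> carrier B" using \<phi> x by (auto simp: star_hom_def)
  show ?thesis
  proof (cases "cnorm A x = 0")
    case True
    then have "x = 0 \<odot>\<^bsub>A\<^esub> x" using x by (simp add: A.cnorm_eq_0_iff A.smult_0_left)
    then have "\<phi> x = 0 \<odot>\<^bsub>B\<^esub> \<phi> x" using \<phi> x unfolding star_hom_def by metis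
    then show ?thesis using \<phi>x True B.cnorm_smult[of "\<phi> x" 0] by simp
  next
    case False
    \<comment> \<open>Scaling by \<open>r\<close> brings \<open>x\<close> to norm exactly
      1/2.\<close>
    define r where "r = 1 / (2 * cnorm A x)"
    have r: "r > 0" using False A.cnorm_nonneg[OF x] by (simp add: r_def)
    have "cnorm B (\<phi> (of_real r \<odot>\<^bsub>A\<^esub> x)) \<le> 1"
      using r x False by (intro unit) (simp_all add: A.smult_closed A.cnorm_smult, simp add: r_def)
    then have "r * cnorm B (\<phi> x) \<le> 1"
      using \<phi> x \<phi>x r by (simp add: star_hom_def B.cnorm_smult)
    then show ?thesis
      using False A.cnorm_nonneg[OF x] by (simp add: r_def field_simps)
  qed
qed

text \<open>The set on which the two maps agree is a C*-subalgebra containing \<open>G\<close>. Its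
  closedness under limits is where boundedness enters.\<close>

lemma star_hom_eq_on_generated:
  assumes A: "cstar_algebra A" and B: "cstar_algebra B"
    and \<phi>: "star_hom A B \<phi>" and \<psi>: "star_hom A B \<psi>"
    and gen: "cstar_generated_by A G" and eq: "\<And>x. x \<in> G \<Longrightarrow> \<phi> x = \<psi> x"
    and x: "x \<in> carrier A"
  shows "\<phi> x = \<psi> x"
proof -
  interpret A: cstar_algebra A by fact
  interpret B: cstar_algebra B by fact
  define S where "S = {x \<in> carrier A. \<phi> x = \<psi> x}"
  have closed: "y \<in> S" if X: "\<And>n. X n \<in> S" and y: "y \<in> carrier A"
    and lim: "(\<lambda>n::nat. cnorm A (X n \<ominus>\<^bsub>A\<^esub> y)) \<longlonglongrightarrow> 0" for X y
  proof -
    have XA: "X n \<in> carrier A" for n using X by (simp add: S_def)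
    have bound: "cnorm B (\<theta> y \<ominus>\<^bsub>B\<^esub> \<theta> (X n)) \<le> 2 * cnorm A (X n \<ominus>\<^bsub>A\<^esub> y)"
      if "star_hom A B \<theta>" for \<theta> n
      using star_hom_bounded[OF A B that, of "y \<ominus>\<^bsub>A\<^esub> X n"] y XA[of n]
      by (simp add: star_hom_diff[OF A B that] A.cnorm_diff_commute)
    have "\<phi> y = \<psi> y"
    proof (rule B.limit_unique[where w = "\<lambda>n. \<phi> (X n)"])
      show "(\<lambda>n. 2 * cnorm A (X n \<ominus>\<^bsub>A\<^esub> y)) \<longlonglongrightarrow> 0"
        using tendsto_mult_left[OF lim, of 2] by simp
      show "cnorm B (\<psi> y \<ominus>\<^bsub>B\<^esub> \<phi> (X n)) \<le> 2 * cnorm A (X n \<ominus>\<^bsub>A\<^esub> y)" for n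
        using bound[OF \<psi>, of n] X[of n] by (simp add: S_def)
    qed (use y XA \<phi> \<psi> bound[OF \<phi>] in \<open>auto simp: star_hom_def\<close>)
    then show ?thesis using y by (simp add: S_def)
  qed
  have zero: "\<theta> \<zero>\<^bsub>A\<^esub> = \<zero>\<^bsub>B\<^esub>" if "star_hom A B \<theta>" for \<theta>
  proof -
    have "\<theta> (0 \<odot>\<^bsub>A\<^esub> \<zero>\<^bsub>A\<^esub>) = 0 \<odot>\<^bsub>B\<^esub> \<theta> \<zero>\<^bsub>A\<^esub>" "\<theta> \<zero>\<^bsub>A\<^esub> \<in> carrier B"
      using that A.zero_closed unfolding star_hom_def by auto
    then show ?thesis by (simp add: A.smult_0_left B.smult_0_left)
  qed
  have "cstar_subalgebra A S"
    unfolding cstar_subalgebra_def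
    using \<phi> \<psi> zero[OF \<phi>] zero[OF \<psi>] closed
    by (auto simp: S_def star_hom_def A.smult_closed A.mult_closed A.star_closed)
  moreover have "G \<subseteq> S"
    using gen eq by (auto simp: S_def cstar_generated_by_def)
  ultimately have "S = carrier A"
    using gen by (simp add: cstar_generated_by_def)
  then show ?thesis using x by (auto simp: S_def)
qed

section \<open>Pullback along a factor map\<close>

definition vanishing_extension :: "('x \<Rightarrow> complex) \<Rightarrow> 'x option \<Rightarrow> complex" where
  "vanishing_extension f = case_option 0 f"

text \<open>A closed set containing 0 has a preimage that contains infinity and whose complement is
  open in \<open>X\<close>. A closed set missing 0 stays at a positive distance \<open>e\<close>
  from it, so its preimage is a closed subset of a compact superlevel set.\<close>

lemma continuous_map_vanishing_extension:
  assumes f: "f \<in> C0 X"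
  shows "continuous_map (Alexandroff_compactification X) euclidean (vanishing_extension f)"
proof -
  have "closedin (Alexandroff_compactification X)
          {p \<in> topspace (Alexandroff_compactification X). vanishing_extension f p \<in> C}"
    if C: "closed C" for C
  proof (cases "0 \<in> C")
    case True
    have "{p \<in> topspace (Alexandroff_compactification X). vanishing_extension f p \<in> C} =
          topspace (Alexandroff_compactification X) - Some ` {x \<in> topspace X. f x \<in> - C}"
      using True by (auto simp: vanishing_extension_def)
    moreover have "openin X {x \<in> topspace X. f x \<in> - C}"
      using f C by (intro openin_continuous_map_preimage[of X euclidean]) (auto simp: C0_def)
    ultimately show ?thesis
      unfolding closedin_Alexandroff_compactification by blast
  next
    case False
    define K where "K = {x \<in> topspace X. f x \<in> C}"
    obtain e where e: "e > 0" "ball 0 e \<subseteq> - C"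
      using C False open_contains_ball[of "- C"] by auto
    have "closedin X K"
      unfolding K_def
      using f C by (intro closedin_continuous_map_preimage[of X euclidean]) (auto simp: C0_def)
    moreover have "K \<subseteq> {x \<in> topspace X. e \<le> cmod (f x)}"
      using e(2) by (force simp: K_def subset_iff not_le)
    moreover have "compactin X {x \<in> topspace X. e \<le> cmod (f x)}"
      using f e by (simp add: C0_def)
    ultimately have "compactin X K" "closedin X K"
      using closed_compactin by blast+
    moreover have "{p \<in> topspace (Alexandroff_compactification X). vanishing_extension f p \<in> C} = Some ` K"
      using False by (auto simp: vanishing_extension_def K_def)
    ultimately show ?thesis
      by simp
  qed
  then show ?thesis
    by (simp add: continuous_map_closedin)
qed

text \<open>The composite \<open>g\<close> is continuous on the compactification and vanishes at
  \<open>None\<close>. A superlevel set of its modulus is therefore closed and misses infinity,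
  which makes it the image of a compact subset of \<open>X\<close>.\<close>

lemma pullback_in_C0:
  assumes f: "f \<in> C0 Y" and m: "m None = None"
    and cont: "continuous_map (Alexandroff_compactification X) (Alexandroff_compactification Y) m"
  shows "pullback X m f \<in> C0 X"
proof -
  define g where "g = vanishing_extension f \<circ> m"
  have g: "continuous_map (Alexandroff_compactification X) euclidean g"
    unfolding g_def using continuous_map_compose[OF cont continuous_map_vanishing_extension[OF f]] .
  have pg: "pullback X m f x = g (Some x)" if "x \<in> topspace X" for x
    using that by (simp add: pullback_def g_def vanishing_extension_def)
  have "continuous_map X euclidean (g \<circ> Some)"
    using continuous_map_compose[OF continuous_map_Some g] .
  then have "continuous_map X euclidean (pullback X m f)"
    by (rule continuous_map_eq) (simp add: pg)
  moreover have "compactin X {x \<in> topspace X. \<epsilon> \<le> cmod (pullback X m f x)}" if "\<epsilon> > 0" for \<epsilon>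
  proof -
    define K where "K = {x \<in> topspace X. \<epsilon> \<le> cmod (pullback X m f x)}"
    have "g None = 0" by (simp add: g_def m vanishing_extension_def)
    then have "{p \<in> topspace (Alexandroff_compactification X). g p \<in> {z. \<epsilon> \<le> cmod z}} = Some ` K"
      using \<open>\<epsilon> > 0\<close> by (auto simp: K_def pg)
    moreover have "closed {z. \<epsilon> \<le> cmod z}"
      by (intro closed_Collect_le continuous_intros)
    then have "closedin (Alexandroff_compactification X)
        {p \<in> topspace (Alexandroff_compactification X). g p \<in> {z. \<epsilon> \<le> cmod z}}"
      by (intro closedin_continuous_map_preimage[OF g]) simp
    ultimately show ?thesis by (simp add: K_def)
  qed
  ultimately show ?thesis
    by (simp add: C0_def pullback_def)
qed

section \<open>Fibers, inner products and left actions under a factor map\<close>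

lemma local_homeomorphism_map_imp_image_subset:
  assumes "local_homeomorphism_map X Y f"
  shows "f ` topspace X \<subseteq> topspace Y"
proof (rule image_subsetI)
  fix x assume "x \<in> topspace X"
  with assms obtain U where "x \<in> U" "openin Y (f ` U)"
    unfolding local_homeomorphism_map_def by meson
  then show "f x \<in> topspace Y" using openin_subset by blast
qed

text \<open>Condition (i) speaks only of edges \<open>e'\<close> of \<open>E\<close>. That a finite
  value of \<open>m1\<close> is such an edge comes from continuity, since a continuous map respects
  the underlying spaces.\<close>

lemma factor_map_edge:
  assumes m: "factor_map F E m0 m1" and e: "e \<in> topspace (edges F)" "m1 (Some e) = Some e'"
  shows "e' \<in> topspace (edges E)" "m0 (Some (ran F e)) = Some (ran E e')"
    "m0 (Some (dom F e)) = Some (dom E e')"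
proof -
  have "m1 \<in> topspace (Alexandroff_compactification (edges F)) \<rightarrow> topspace (Alexandroff_compactification (edges E))"
    using m unfolding factor_map_def by (blast dest: continuous_map_funspace)
  then have "m1 (Some e) \<in> topspace (Alexandroff_compactification (edges E))"
    using e(1) by (simp add: Pi_iff)
  then show "e' \<in> topspace (edges E)"
    using e(2) by auto
  then show "m0 (Some (ran F e)) = Some (ran E e')" "m0 (Some (dom F e)) = Some (dom E e')"
    using m e unfolding factor_map_def by auto
qed

text \<open>Condition (i) sends the edges into the fiber over \<open>w\<close>. The existence part
  of condition (ii) gives surjectivity and its uniqueness part injectivity.\<close>

lemma fiber_bij_betw:
  assumes m: "factor_map F E m0 m1" and v: "v \<in> topspace (verts F)" "m0 (Some v) = Some w"
  shows "bij_betw (\<lambda>e. the (m1 (Some e))) {e \<in> fiber F v. m1 (Some e) \<noteq> None} (fiber E w)"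
proof (rule bij_betw_imageI)
  have fib: "e' \<in> fiber E w" if "e \<in> fiber F v" "m1 (Some e) = Some e'" for e e'
    using factor_map_edge[OF m, of e e'] that v by (simp add: fiber_def)
  have uniq: "\<exists>!e. e \<in> topspace (edges F) \<and> m1 (Some e) = Some e' \<and> dom F e = v" if "e' \<in> fiber E w" for e'
    using m v that unfolding factor_map_def fiber_def by auto
  show "inj_on (\<lambda>e. the (m1 (Some e))) {e \<in> fiber F v. m1 (Some e) \<noteq> None}"
  proof (rule inj_onI; clarsimp)
    fix a b d assume *: "a \<in> fiber F v" "b \<in> fiber F v" "m1 (Some a) = Some d" "m1 (Some b) = Some d"
    from uniq[OF fib[OF *(1,3)]] * show "a = b" by (auto simp: fiber_def)
  qed
  show "(\<lambda>e. the (m1 (Some e))) ` {e \<in> fiber F v. m1 (Some e) \<noteq> None} = fiber E w"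
  proof
    show "(\<lambda>e. the (m1 (Some e))) ` {e \<in> fiber F v. m1 (Some e) \<noteq> None} \<subseteq> fiber E w"
      using fib by auto
    show "fiber E w \<subseteq> (\<lambda>e. the (m1 (Some e))) ` {e \<in> fiber F v. m1 (Some e) \<noteq> None}"
    proof
      fix e' assume "e' \<in> fiber E w"
      with uniq obtain e where "e \<in> topspace (edges F)" "m1 (Some e) = Some e'" "dom F e = v" by blast
      then show "e' \<in> (\<lambda>e. the (m1 (Some e))) ` {e \<in> fiber F v. m1 (Some e) \<noteq> None}"
        by (intro image_eqI[of _ _ e]) (auto simp: fiber_def)
    qed
  qed
qed

text \<open>The function \<open>c\<close> is left general to cover both inner products and sums of
  squares. Edges sent to infinity contribute \<open>c 0 0 = 0\<close>, and the others are reindexed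
  by the bijection of fibers. If \<open>v\<close> goes to infinity, then so do all edges in its
  fiber.\<close>

lemma fiber_sum_pullback:
  fixes c :: "complex \<Rightarrow> complex \<Rightarrow> 'z :: {comm_monoid_add, t2_space}"
  assumes m: "factor_map F E m0 m1" and v: "v \<in> topspace (verts F)"
    and c: "c 0 0 = 0"
  defines "p \<equiv> pullback (edges F) m1"
  shows "infsum (\<lambda>e. c (p \<xi> e) (p \<eta> e)) (fiber F v) =
      (case m0 (Some v) of None \<Rightarrow> 0 | Some w \<Rightarrow> infsum (\<lambda>e. c (\<xi> e) (\<eta> e)) (fiber E w))" (is ?sum)
    and "(\<lambda>e. c (p \<xi> e) (p \<eta> e)) summable_on fiber F v \<longleftrightarrow>
      (case m0 (Some v) of None \<Rightarrow> True | Some w \<Rightarrow> (\<lambda>e. c (\<xi> e) (\<eta> e)) summable_on fiber E w)" (is ?summable)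
proof -
  have p: "p f e = (case m1 (Some e) of None \<Rightarrow> 0 | Some e' \<Rightarrow> f e')" if "e \<in> fiber F v" for f e
    using that by (simp add: p_def pullback_def fiber_def)
  have "?sum \<and> ?summable"
  proof (cases "m0 (Some v)")
    case None
    have "p f e = 0" if "e \<in> fiber F v" for f e
    proof (cases "m1 (Some e)")
      case (Some e')
      with factor_map_edge(3)[OF m, of e e'] that None show ?thesis by (simp add: fiber_def)
    qed (use p that in simp)
    then have "infsum (\<lambda>e. c (p \<xi> e) (p \<eta> e)) (fiber F v) = 0"
      "(\<lambda>e. c (p \<xi> e) (p \<eta> e)) summable_on fiber F v"
      by (simp_all add: c infsum_0 summable_on_0)
    then show ?thesis by (simp add: None)
  next
    case (Some w)
    define D where "D = {e \<in> fiber F v. m1 (Some e) \<noteq> None}"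
    note bij = fiber_bij_betw[OF m v Some, folded D_def]
    have eq: "c (p \<xi> e) (p \<eta> e) = c (\<xi> (the (m1 (Some e)))) (\<eta> (the (m1 (Some e))))" if "e \<in> D" for e
      using that p by (auto simp: D_def)
    have 0: "c (p \<xi> e) (p \<eta> e) = 0" if "e \<in> fiber F v - D" for e
      using that p c by (auto simp: D_def)
    have D: "D \<subseteq> fiber F v" by (auto simp: D_def)
    have "infsum (\<lambda>e. c (p \<xi> e) (p \<eta> e)) (fiber F v) =
        infsum (\<lambda>e. c (\<xi> (the (m1 (Some e)))) (\<eta> (the (m1 (Some e))))) D"
      using D eq 0 by (intro infsum_cong_neutral) auto
    moreover have "(\<lambda>e. c (p \<xi> e) (p \<eta> e)) summable_on fiber F v \<longleftrightarrow>
        (\<lambda>e. c (\<xi> (the (m1 (Some e)))) (\<eta> (the (m1 (Some e))))) summable_on D"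
      using D eq 0 by (intro summable_on_cong_neutral) auto
    ultimately show ?thesis
      using infsum_reindex_bij_betw[OF bij, of "\<lambda>e. c (\<xi> e) (\<eta> e)"]
        summable_on_reindex_bij_betw[OF bij, of "\<lambda>e. c (\<xi> e) (\<eta> e)"]
      by (simp add: Some)
  qed
  then show ?sum ?summable by auto
qed

lemma Cd_inner_pullback:
  assumes F: "topological_graph F" and m: "factor_map F E m0 m1"
  shows "Cd_inner F (pullback (edges F) m1 \<xi>) (pullback (edges F) m1 \<eta>) =
    pullback (verts F) m0 (Cd_inner E \<xi> \<eta>)"
proof
  fix v
  show "Cd_inner F (pullback (edges F) m1 \<xi>) (pullback (edges F) m1 \<eta>) v =
    pullback (verts F) m0 (Cd_inner E \<xi> \<eta>) v"
  proof (cases "v \<in> topspace (verts F)")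
    case True
    then show ?thesis
      using fiber_sum_pullback(1)[OF m True, of "\<lambda>x y. cnj x * y" \<xi> \<eta>]
      by (simp add: Cd_inner_def pullback_def split: option.split)
  next
    case False
    \<comment> \<open>Equality is claimed on the whole type. Off the vertex space both sides are 0,
      because \<open>dom F\<close> maps edges to vertices.\<close>
    then have "fiber F v = {}"
      using F local_homeomorphism_map_imp_image_subset[of "edges F" "verts F" "dom F"]
      by (auto simp: fiber_def topological_graph_def)
    then show ?thesis using False by (simp add: Cd_inner_def pullback_def)
  qed
qed

lemma left_action_pullback:
  assumes F: "topological_graph F" and m: "factor_map F E m0 m1"
  shows "left_action F (pullback (verts F) m0 f) (pullback (edges F) m1 \<xi>) =
    pullback (edges F) m1 (left_action E f \<xi>)"
proof
  fix e
  have "ran F e \<in> topspace (verts F)" if "e \<in> topspace (edges F)"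
    using F that unfolding topological_graph_def by (blast dest: continuous_map_image_subset_topspace)
  then show "left_action F (pullback (verts F) m0 f) (pullback (edges F) m1 \<xi>) e =
    pullback (edges F) m1 (left_action E f \<xi>) e"
    using factor_map_edge(2)[OF m, of e]
    by (auto simp: left_action_def pullback_def split: option.split)
qed

section \<open>Functions in \<open>Cd\<close> vanish at infinity\<close>

lemma local_section:
  assumes "local_homeomorphism_map X Y f" "x \<in> topspace X"
  obtains V g where "openin Y V" "f x \<in> V" "continuous_map (subtopology Y V) X g" "g (f x) = x"
    "\<And>y. y \<in> V \<Longrightarrow> f (g y) = y"
proof -
  obtain U where U: "openin X U" "x \<in> U" "openin Y (f ` U)"
    "homeomorphic_map (subtopology X U) (subtopology Y (f ` U)) f"
    using assms unfolding local_homeomorphism_map_def by blast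
  then obtain g where g: "homeomorphic_maps (subtopology X U) (subtopology Y (f ` U)) f g"
    by (auto simp: homeomorphic_map_maps)
  have "U \<subseteq> topspace X" "f ` U \<subseteq> topspace Y" using U openin_subset by blast+
  with g U show ?thesis
    unfolding homeomorphic_maps_def
    by (intro that[of "f ` U" g])
      (auto simp: continuous_map_in_subtopology topspace_subtopology_subset Int_absorb1)
qed

lemma Hausdorff_space_separate_finite:
  assumes "Hausdorff_space X" "finite S" "S \<subseteq> topspace X"
  obtains N where "\<And>x. x \<in> S \<Longrightarrow> openin X (N x)" "\<And>x. x \<in> S \<Longrightarrow> x \<in> N x"
    "\<And>x y. \<lbrakk>x \<in> S; y \<in> S; x \<noteq> y\<rbrakk> \<Longrightarrow> N x \<inter> N y = {}"
proof -
  have "\<exists>U V. openin X U \<and> openin X V \<and> x \<in> U \<and> y \<in> V \<and> disjnt U V" if "x \<in> S" "y \<in> S" "x \<noteq> y" for x y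
    using assms that unfolding Hausdorff_space_def by (meson subsetD)
  then obtain U V where UV: "\<And>x y. \<lbrakk>x \<in> S; y \<in> S; x \<noteq> y\<rbrakk> \<Longrightarrow>
      openin X (U x y) \<and> openin X (V x y) \<and> x \<in> U x y \<and> y \<in> V x y \<and> disjnt (U x y) (V x y)"
    by metis
  \<comment> \<open>Both \<open>U x y\<close> and \<open>V y x\<close> contain \<open>x\<close>.
    With both present, \<open>N x\<close> lies in \<open>U x y\<close> and \<open>N y\<close> in the
    disjoint set \<open>V x y\<close>.\<close>
  define N where "N x = topspace X \<inter> (\<Inter>y \<in> S - {x}. U x y \<inter> V y x)" for x
  show ?thesis
  proof (rule that)
    show "openin X (N x)" if "x \<in> S" for x
    proof (cases "S - {x} = {}")
      case False
      then show ?thesis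
        unfolding N_def using assms(2) UV that by (intro openin_Int openin_INT2 openin_topspace) auto
    next
      case True
      then have "N x = topspace X" unfolding N_def by (simp only: True INT_empty Int_UNIV_right)
      then show ?thesis by simp
    qed
    show "x \<in> N x" if "x \<in> S" for x using that UV assms by (auto simp: N_def)
    show "N x \<inter> N y = {}" if "x \<in> S" "y \<in> S" "x \<noteq> y" for x y
      using that UV[of x y] unfolding N_def disjnt_def by blast
  qed
qed

text \<open>Since \<open>Re\<close> is a bounded linear left inverse of \<open>of_real\<close>,
  either both sums converge or both take the default value 0.\<close>

lemma Cd_inner_self:
  "Cd_inner E \<xi> \<xi> v = of_real (infsum (\<lambda>e. (cmod (\<xi> e))\<^sup>2) (fiber E v))"
proof -
  have "cnj (\<xi> e) * \<xi> e = of_real ((cmod (\<xi> e))\<^sup>2)" for e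
    using complex_norm_square[of "\<xi> e"] by (simp add: mult.commute)
  moreover have "infsum (\<lambda>e. of_real (h e) :: complex) X = of_real (infsum h X)" for h and X :: "'b set"
    by (intro infsum_bounded_linear_strong bounded_linear_of_real
          summable_on_bounded_linear_iff[of _ Re] bounded_linear_Re) simp
  ultimately show ?thesis
    by (simp only: Cd_inner_def)
qed

text \<open>
  Near \<open>v0\<close>, finitely many local sections of \<open>dom E\<close> already carry the sum \<open>\<langle>\<xi>,\<xi>\<rangle>\<close> up to \<open>\<epsilon>\<^sup>2\<close>, so
  an edge with \<open>|\<xi>| \<ge> \<epsilon>\<close> over such a vertex lies in the image of one of them.
\<close>
lemma Cd_locally_compact_support:
  assumes E: "topological_graph E" and \<xi>: "\<xi> \<in> Cd E" and \<epsilon>: "\<epsilon> > 0" and v0: "v0 \<in> topspace (verts E)"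
  shows "\<exists>V C. openin (verts E) V \<and> v0 \<in> V \<and> compactin (edges E) C \<and>
      (\<forall>e\<in>topspace (edges E). dom E e \<in> V \<and> \<epsilon> \<le> cmod (\<xi> e) \<longrightarrow> e \<in> C)"
proof -
  define \<phi> where "\<phi> = (\<lambda>e. (cmod (\<xi> e))\<^sup>2)"
  define G where "G v = infsum \<phi> (fiber E v)" for v
  have summable: "\<phi> summable_on fiber E v" if "v \<in> topspace (verts E)" for v
    using \<xi> that by (simp add: Cd_def \<phi>_def)
  have inner: "Cd_inner E \<xi> \<xi> v = of_real (G v)" for v
    by (simp add: Cd_inner_self G_def \<phi>_def)
  have "continuous_map (verts E) euclidean (Cd_inner E \<xi> \<xi>)"
    using \<xi> by (simp add: Cd_def C0_def)
  then have "continuous_map (verts E) euclideanreal (\<lambda>v. Re (Cd_inner E \<xi> \<xi> v))"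
    using continuous_map_compose[of "verts E" euclidean "Cd_inner E \<xi> \<xi>" euclideanreal Re]
    by (simp add: o_def continuous_intros)
  then have G_cont: "continuous_map (verts E) euclideanreal G"
    by (simp add: inner)
  have \<phi>_cont: "continuous_map (edges E) euclideanreal \<phi>"
  proof -
    have "continuous_map (edges E) euclideanreal ((\<lambda>z. (cmod z)\<^sup>2) \<circ> \<xi>)"
      using \<xi> by (intro continuous_map_compose[of _ euclidean])
        (auto simp: Cd_def intro!: continuous_intros)
    then show ?thesis by (simp add: \<phi>_def o_def)
  qed
  \<comment> \<open>The missing part of the sum is at most \<open>\<epsilon>\<^sup>2 / 2\<close> at
    \<open>v0\<close>, which leaves room to stay below \<open>\<epsilon>\<^sup>2\<close>
    nearby.\<close>
  obtain S where S: "finite S" "S \<subseteq> fiber E v0" "dist (sum \<phi> S) (G v0) \<le> \<epsilon>\<^sup>2 / 2"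
    using infsum_finite_approximation[OF summable[OF v0], of "\<epsilon>\<^sup>2 / 2"] \<epsilon> by (auto simp: G_def)
  then have S_edges: "S \<subseteq> topspace (edges E)" and S_dom: "\<And>e. e \<in> S \<Longrightarrow> dom E e = v0"
    by (auto simp: fiber_def)
  obtain N where N: "\<And>e. e \<in> S \<Longrightarrow> openin (edges E) (N e)" "\<And>e. e \<in> S \<Longrightarrow> e \<in> N e"
    "\<And>e e'. \<lbrakk>e \<in> S; e' \<in> S; e \<noteq> e'\<rbrakk> \<Longrightarrow> N e \<inter> N e' = {}"
    using Hausdorff_space_separate_finite[of "edges E" S] E S S_edges
    unfolding topological_graph_def by metis
  define section_at where "section_at e V g \<longleftrightarrow> openin (verts E) V \<and> v0 \<in> V \<and>
      continuous_map (subtopology (verts E) V) (edges E) g \<and> g v0 = e \<and> (\<forall>v\<in>V. dom E (g v) = v)" for e V g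
  have "\<exists>V g. section_at e V g" if e: "e \<in> S" for e
  proof -
    have "local_homeomorphism_map (edges E) (verts E) (dom E)" "e \<in> topspace (edges E)"
      using E S_edges e by (auto simp: topological_graph_def)
    then obtain V g where "openin (verts E) V" "dom E e \<in> V"
      "continuous_map (subtopology (verts E) V) (edges E) g" "g (dom E e) = e" "\<And>v. v \<in> V \<Longrightarrow> dom E (g v) = v"
      by (rule local_section) blast
    then show ?thesis
      using S_dom[OF e] unfolding section_at_def by auto
  qed
  then obtain V g where "\<And>e. e \<in> S \<Longrightarrow> section_at e (V e) (g e)"
    by metis
  then have Vg: "\<And>e. e \<in> S \<Longrightarrow> openin (verts E) (V e)" "\<And>e. e \<in> S \<Longrightarrow> v0 \<in> V e"
    "\<And>e. e \<in> S \<Longrightarrow> continuous_map (subtopology (verts E) (V e)) (edges E) (g e)"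
    "\<And>e. e \<in> S \<Longrightarrow> g e v0 = e" "\<And>e v. \<lbrakk>e \<in> S; v \<in> V e\<rbrakk> \<Longrightarrow> dom E (g e v) = v"
    unfolding section_at_def by blast+
  have V_sub: "V e \<subseteq> topspace (verts E)" if "e \<in> S" for e
    using Vg(1)[OF that] openin_subset by blast
  \<comment> \<open>Over \<open>W0\<close> all chosen sections are defined and stay in the disjoint
    sets \<open>N e\<close>, so different sections pass through different edges.\<close>
  define W0 where "W0 = topspace (verts E) \<inter> (\<Inter>e\<in>S. {v \<in> V e. g e v \<in> N e})"
  have W0_open: "openin (verts E) W0"
  proof -
    have "openin (verts E) {v \<in> V e. g e v \<in> N e}" if "e \<in> S" for e
    proof (rule openin_trans_full)
      have "{v \<in> V e. g e v \<in> N e} = {v \<in> topspace (subtopology (verts E) (V e)). g e v \<in> N e}"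
        using V_sub[OF that] by auto
      then show "openin (subtopology (verts E) (V e)) {v \<in> V e. g e v \<in> N e}"
        using openin_continuous_map_preimage[OF Vg(3)[OF that] N(1)[OF that]] by simp
    qed (use Vg that in blast)
    then show ?thesis
      unfolding W0_def using S(1)
      by (cases "S = {}") (auto intro!: openin_Int openin_INT2)
  qed
  have g_edges: "g e v \<in> topspace (edges E)" if "e \<in> S" "v \<in> V e" for e v
    using continuous_map_image_subset_topspace[OF Vg(3)[OF that(1)]] V_sub[OF that(1)] that(2) by auto
  define H where "H v = (\<Sum>e\<in>S. \<phi> (g e v))" for v
  have "continuous_map (subtopology (verts E) W0) euclideanreal H"
    unfolding H_def
  proof (rule continuous_map_sum)
    fix e assume e: "e \<in> S"
    then have "W0 \<subseteq> V e" by (auto simp: W0_def)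
    then have "continuous_map (subtopology (verts E) W0) (edges E) (g e)"
      using continuous_map_from_subtopology_mono[OF Vg(3)[OF e]] by blast
    then show "continuous_map (subtopology (verts E) W0) euclideanreal (\<lambda>v. \<phi> (g e v))"
      using continuous_map_compose[OF _ \<phi>_cont] by (auto simp: o_def)
  qed (use S in auto)
  then have GH_cont: "continuous_map (subtopology (verts E) W0) euclideanreal (\<lambda>v. G v - H v)"
    by (intro continuous_map_diff continuous_map_from_subtopology[OF G_cont])
  \<comment> \<open>\<open>G v - H v\<close> is the part of
    \<open>\<langle>\<xi>,\<xi>\<rangle>\<close> at \<open>v\<close> not carried by the
    sections.\<close>
  define W where "W = {v \<in> topspace (subtopology (verts E) W0). G v - H v \<in> {..<\<epsilon>\<^sup>2}}"
  have "openin (verts E) W"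
    unfolding W_def
    by (rule openin_trans_full[OF openin_continuous_map_preimage[OF GH_cont] W0_open]) simp
  moreover have "v0 \<in> W"
  proof -
    have "H v0 = sum \<phi> S" by (simp add: H_def Vg(4))
    then have "G v0 - H v0 \<le> \<epsilon>\<^sup>2 / 2"
      using S(3) unfolding dist_real_def by linarith
    also have "\<dots> < \<epsilon>\<^sup>2"
      using \<epsilon> by simp
    finally have "G v0 - H v0 < \<epsilon>\<^sup>2" .
    then show ?thesis using v0 Vg N by (auto simp: W_def W0_def)
  qed
  \<comment> \<open>Local compactness provides a compact neighbourhood \<open>K\<close> inside
    \<open>W\<close>, whose images under the finitely many sections form the compact set
    \<open>C\<close>.\<close>
  moreover have "neighbourhood_base_of (compactin (verts E)) (verts E)"
    using E locally_compact_space_neighbourhood_base unfolding topological_graph_def by blast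
  ultimately obtain V1 K where V1: "openin (verts E) V1" "v0 \<in> V1" "V1 \<subseteq> K" "K \<subseteq> W" and K: "compactin (verts E) K"
    unfolding neighbourhood_base_of by meson
  have KV: "K \<subseteq> V e" if "e \<in> S" for e
    using V1 that by (auto simp: W_def W0_def)
  define C where "C = (\<Union>e\<in>S. g e ` K)"
  have "compactin (edges E) C"
    unfolding C_def
  proof (intro compactin_Union)
    fix D assume "D \<in> (\<lambda>e. g e ` K) ` S"
    then obtain e where e: "e \<in> S" "D = g e ` K" by blast
    have "compactin (subtopology (verts E) (V e)) K"
      using K KV[OF e(1)] by (simp add: compactin_subtopology)
    then show "compactin (edges E) D"
      using image_compactin[OF _ Vg(3)[OF e(1)]] e(2) by simp
  qed (use S in auto)
  moreover have "e \<in> C" if e: "e \<in> topspace (edges E)" "dom E e \<in> V1" "\<epsilon> \<le> cmod (\<xi> e)" for e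
  proof (rule ccontr)
    assume "e \<notin> C"
    define v where "v = dom E e"
    have v: "v \<in> K" "v \<in> W0" "v \<in> topspace (verts E)" "G v - H v < \<epsilon>\<^sup>2"
      using e V1 by (auto simp: v_def W_def)
    have notin: "e \<notin> (\<lambda>i. g i v) ` S"
      using \<open>e \<notin> C\<close> v by (auto simp: C_def)
    have inj: "inj_on (\<lambda>i. g i v) S"
    proof (rule inj_onI)
      fix i j assume "i \<in> S" "j \<in> S" "g i v = g j v"
      moreover from this have "g i v \<in> N i \<inter> N j" using v(2) by (auto simp: W0_def)
      ultimately show "i = j" using N(3)[of i j] by blast
    qed
    have "v \<in> V i" if "i \<in> S" for i
      using KV[OF that] v(1) by blast
    \<comment> \<open>The edge \<open>e\<close> is a further member of the fiber, so it adds at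
      least \<open>\<epsilon>\<^sup>2\<close> to \<open>H v\<close> within the total
      \<open>G v\<close>, contrary to the choice of \<open>W\<close>.\<close>
    then have "insert e ((\<lambda>i. g i v) ` S) \<subseteq> fiber E v"
      using e(1) Vg(5) g_edges by (auto simp: fiber_def v_def[symmetric])
    then have "sum \<phi> (insert e ((\<lambda>i. g i v) ` S)) \<le> G v"
      unfolding G_def using S(1) summable[OF v(3)]
      by (intro finite_sum_le_infsum) (auto simp: \<phi>_def)
    then have "\<phi> e + H v \<le> G v"
      using notin S(1) inj by (simp add: sum.reindex H_def)
    moreover have "\<epsilon>\<^sup>2 \<le> \<phi> e"
      unfolding \<phi>_def using e(3) \<epsilon> by (intro power_mono) auto
    ultimately show False using v(4) by simp
  qed
  ultimately show ?thesis using V1 by blast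
qed

text \<open>The preimage of a compact set under \<open>dom E\<close> need not be compact. Instead,
  the edges with \<open>\<epsilon> \<le> cmod (\<xi> e)\<close> lie over a compact set
  \<open>K\<close>, finitely many of the local neighbourhoods cover \<open>K\<close>, and the
  corresponding compact sets contain all these edges.\<close>

lemma Cd_subset_C0:
  assumes E: "topological_graph E" and \<xi>: "\<xi> \<in> Cd E"
  shows "\<xi> \<in> C0 (edges E)"
proof -
  have cont: "continuous_map (edges E) euclidean \<xi>" using \<xi> by (simp add: Cd_def)
  have "compactin (edges E) {e \<in> topspace (edges E). \<epsilon> \<le> cmod (\<xi> e)}" if \<epsilon>: "\<epsilon> > 0" for \<epsilon>
  proof -
    define A where "A = {e \<in> topspace (edges E). \<epsilon> \<le> cmod (\<xi> e)}"
    have "closed {z. \<epsilon> \<le> cmod z}"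
      by (intro closed_Collect_le continuous_intros)
    then have A: "closedin (edges E) A"
      using closedin_continuous_map_preimage[OF cont, of "{z. \<epsilon> \<le> cmod z}"] by (simp add: A_def)
    define K where "K = {v \<in> topspace (verts E). \<epsilon>\<^sup>2 \<le> cmod (Cd_inner E \<xi> \<xi> v)}"
    have K: "compactin (verts E) K"
      using \<xi> \<epsilon> by (simp add: Cd_def C0_def K_def)
    \<comment> \<open>A single edge already contributes its square, at least
      \<open>\<epsilon>\<^sup>2\<close>, to the inner product.\<close>
    have AK: "dom E e \<in> K" if "e \<in> A" for e
    proof -
      have e: "e \<in> topspace (edges E)" "\<epsilon> \<le> cmod (\<xi> e)" using that by (auto simp: A_def)
      then have d: "dom E e \<in> topspace (verts E)"
        using E local_homeomorphism_map_imp_image_subset[of "edges E" "verts E" "dom E"]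
        by (auto simp: topological_graph_def)
      have "(\<Sum>x\<in>{e}. (cmod (\<xi> x))\<^sup>2) \<le> infsum (\<lambda>x. (cmod (\<xi> x))\<^sup>2) (fiber E (dom E e))"
        using \<xi> d e by (intro finite_sum_le_infsum) (auto simp: Cd_def fiber_def)
      moreover have "\<epsilon>\<^sup>2 \<le> (cmod (\<xi> e))\<^sup>2"
        using e \<epsilon> by (intro power_mono) auto
      ultimately show ?thesis using d by (simp add: K_def Cd_inner_self)
    qed
    have "\<forall>v\<in>K. \<exists>V C. openin (verts E) V \<and> v \<in> V \<and> compactin (edges E) C \<and>
      (\<forall>e\<in>topspace (edges E). dom E e \<in> V \<and> \<epsilon> \<le> cmod (\<xi> e) \<longrightarrow> e \<in> C)"
      using Cd_locally_compact_support[OF E \<xi> \<epsilon>] by (simp add: K_def)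
    then obtain V C where VC: "\<And>v. v \<in> K \<Longrightarrow> openin (verts E) (V v)" "\<And>v. v \<in> K \<Longrightarrow> v \<in> V v"
      "\<And>v. v \<in> K \<Longrightarrow> compactin (edges E) (C v)"
      "\<And>v e. \<lbrakk>v \<in> K; e \<in> A; dom E e \<in> V v\<rbrakk> \<Longrightarrow> e \<in> C v"
      unfolding A_def by (metis (no_types, lifting) mem_Collect_eq)
    have "\<exists>\<F>. finite \<F> \<and> \<F> \<subseteq> V ` K \<and> K \<subseteq> \<Union>\<F>"
      using VC(1,2) by (intro compactinD[OF K]) auto
    then obtain K' where K': "finite K'" "K' \<subseteq> K" "K \<subseteq> (\<Union>v\<in>K'. V v)"
      by (metis finite_subset_image)
    have "compactin (edges E) (\<Union>v\<in>K'. C v)"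
      using K' VC(3) by (intro compactin_Union) auto
    moreover have "A \<subseteq> (\<Union>v\<in>K'. C v)"
    proof
      fix e assume "e \<in> A"
      with AK K' obtain v where "v \<in> K'" "dom E e \<in> V v" by blast
      with VC(4) K'(2) \<open>e \<in> A\<close> show "e \<in> (\<Union>v\<in>K'. C v)" by blast
    qed
    ultimately show ?thesis
      using A closed_compactin unfolding A_def by blast
  qed
  then show ?thesis using \<xi> by (simp add: Cd_def C0_def)
qed

section \<open>The pulled-back Toeplitz pair and the induced homomorphism\<close>

lemma pullback_in_Cd:
  assumes E: "topological_graph E" and F: "topological_graph F" and m: "factor_map F E m0 m1"
    and \<xi>: "\<xi> \<in> Cd E"
  shows "pullback (edges F) m1 \<xi> \<in> Cd F"
proof -
  \<comment> \<open>Vanishing of \<open>\<xi>\<close> at infinity makes the pullback continuous also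
    at edges that \<open>m1\<close> sends to infinity.\<close>
  have "pullback (edges F) m1 \<xi> \<in> C0 (edges F)"
    using m by (intro pullback_in_C0[OF Cd_subset_C0[OF E \<xi>]]) (auto simp: factor_map_def)
  moreover have "Cd_inner F (pullback (edges F) m1 \<xi>) (pullback (edges F) m1 \<xi>) \<in> C0 (verts F)"
    unfolding Cd_inner_pullback[OF F m]
    using m \<xi> by (intro pullback_in_C0) (auto simp: factor_map_def Cd_def)
  moreover have "(\<lambda>e. (cmod (pullback (edges F) m1 \<xi> e))\<^sup>2) summable_on fiber F v"
    if v: "v \<in> topspace (verts F)" for v
  proof -
    have "m0 \<in> topspace (Alexandroff_compactification (verts F)) \<rightarrow> topspace (Alexandroff_compactification (verts E))"
      using m unfolding factor_map_def by (blast dest: continuous_map_funspace)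
    then have "m0 (Some v) \<in> topspace (Alexandroff_compactification (verts E))"
      using v by (simp add: Pi_iff)
    then show ?thesis
      using fiber_sum_pullback(2)[OF m v, of "\<lambda>x y. (cmod x)\<^sup>2" \<xi> \<xi>] \<xi>
      by (auto simp: Cd_def split: option.splits)
  qed
  ultimately show ?thesis
    by (simp add: Cd_def C0_def)
qed

text \<open>The algebraic operations are pointwise, so pulling back respects them. The two Toeplitz
  relations transfer because pulling back also commutes with inner products and left
  actions.\<close>

lemma toeplitz_pair_pullback:
  assumes E: "topological_graph E" and F: "topological_graph F" and m: "factor_map F E m0 m1"
    and T: "toeplitz_pair F B T0 T1"
  shows "toeplitz_pair E B (\<lambda>f. T0 (pullback (verts F) m0 f)) (\<lambda>\<xi>. T1 (pullback (edges F) m1 \<xi>))"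
proof -
  define p where "p = pullback (verts F) m0"
  define q where "q = pullback (edges F) m1"
  have p: "p f \<in> C0 (verts F)" if "f \<in> C0 (verts E)" for f
    unfolding p_def using m that by (intro pullback_in_C0) (auto simp: factor_map_def)
  have q: "q \<xi> \<in> Cd F" if "\<xi> \<in> Cd E" for \<xi>
    unfolding q_def by (rule pullback_in_Cd[OF E F m that])
  have p_hom: "p (\<lambda>x. f x + g x) = (\<lambda>x. p f x + p g x)" "p (\<lambda>x. a * f x) = (\<lambda>x. a * p f x)"
     "p (\<lambda>x. f x * g x) = (\<lambda>x. p f x * p g x)" "p (\<lambda>x. cnj (f x)) = (\<lambda>x. cnj (p f x))" for f g a
    by (auto simp: p_def pullback_def fun_eq_iff split: option.split)
  have q_hom: "q (\<lambda>x. f x + g x) = (\<lambda>x. q f x + q g x)" "q (\<lambda>x. a * f x) = (\<lambda>x. a * q f x)" for f g a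
    by (auto simp: q_def pullback_def fun_eq_iff split: option.split)
  have inner: "Cd_inner F (q \<xi>) (q \<eta>) = p (Cd_inner E \<xi> \<eta>)" for \<xi> \<eta>
    unfolding p_def q_def by (rule Cd_inner_pullback[OF F m])
  have act: "left_action F (p f) (q \<xi>) = q (left_action E f \<xi>)" for f \<xi>
    unfolding p_def q_def by (rule left_action_pullback[OF F m])
  show ?thesis
    unfolding p_def[symmetric] q_def[symmetric]
    using T p q
    by (simp add: toeplitz_pair_def star_hom_def C0_alg_def p_hom q_hom Pi_iff inner[symmetric] act[symmetric])
qed

theorem proposition2p3:
  fixes E :: "('v, 'e) tgraph" and F :: "('w, 'f) tgraph"
    and m0 :: "'w option \<Rightarrow> 'v option" and m1 :: "'f option \<Rightarrow> 'e option"
    and TE :: "'a cstar_alg" and TE0 :: "('v \<Rightarrow> complex) \<Rightarrow> 'a" and TE1 :: "('e \<Rightarrow> complex) \<Rightarrow> 'a"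
    and TF :: "'b cstar_alg" and TF0 :: "('w \<Rightarrow> complex) \<Rightarrow> 'b" and TF1 :: "('f \<Rightarrow> complex) \<Rightarrow> 'b"
  assumes "topological_graph E" and "topological_graph F"
    and "factor_map F E m0 m1"
    and "universal_toeplitz_pair TYPE('b) E TE TE0 TE1"
    and "universal_toeplitz_pair TYPE('c) F TF TF0 TF1"
  shows "\<exists>!\<mu>. \<mu> \<in> extensional (carrier TE) \<and> star_hom TE TF \<mu> \<and>
           (\<forall>f\<in>C0 (verts E). \<mu> (TE0 f) = TF0 (pullback (verts F) m0 f)) \<and>
           (\<forall>\<xi>\<in>Cd E. \<mu> (TE1 \<xi>) = TF1 (pullback (edges F) m1 \<xi>))"
proof -
  have TE: "cstar_algebra TE" "toeplitz_pair E TE TE0 TE1"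
    "cstar_generated_by TE (TE0 ` C0 (verts E) \<union> TE1 ` Cd E)"
    using assms(4) by (simp_all add: universal_toeplitz_pair_def)
  have TF: "cstar_algebra TF" "toeplitz_pair F TF TF0 TF1"
    using assms(5) by (simp_all add: universal_toeplitz_pair_def)
  interpret TE: cstar_algebra TE by fact
  have carr: "TE0 f \<in> carrier TE" if "f \<in> C0 (verts E)" for f
    using TE(2) that by (auto simp: toeplitz_pair_def star_hom_def C0_alg_def)
  have carr': "TE1 \<xi> \<in> carrier TE" if "\<xi> \<in> Cd E" for \<xi>
    using TE(2) that by (auto simp: toeplitz_pair_def)
  \<comment> \<open>\<open>TF\<close> lives on the type \<open>'b\<close> at which universality of
    \<open>TE\<close> is assumed, so it is an admissible target.\<close>
  from toeplitz_pair_pullback[OF assms(1-3) TF(2)] TF(1) assms(4)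
  obtain \<phi> where \<phi>: "star_hom TE TF \<phi>"
    "\<And>f. f \<in> C0 (verts E) \<Longrightarrow> \<phi> (TE0 f) = TF0 (pullback (verts F) m0 f)"
    "\<And>\<xi>. \<xi> \<in> Cd E \<Longrightarrow> \<phi> (TE1 \<xi>) = TF1 (pullback (edges F) m1 \<xi>)"
    unfolding universal_toeplitz_pair_def by blast
  show ?thesis
  \<comment> \<open>Restriction fixes the values off the carrier, so that uniqueness on the carrier
    becomes equality of functions.\<close>
  proof (rule ex1I[of _ "restrict \<phi> (carrier TE)"], intro conjI ballI)
    show "star_hom TE TF (restrict \<phi> (carrier TE))"
      using \<phi>(1) by (auto simp: star_hom_def TE.smult_closed TE.mult_closed TE.star_closed)
  next
    fix \<mu> assume \<mu>: "\<mu> \<in> extensional (carrier TE) \<and> star_hom TE TF \<mu> \<and>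
      (\<forall>f\<in>C0 (verts E). \<mu> (TE0 f) = TF0 (pullback (verts F) m0 f)) \<and>
      (\<forall>\<xi>\<in>Cd E. \<mu> (TE1 \<xi>) = TF1 (pullback (edges F) m1 \<xi>))"
    have "\<mu> x = \<phi> x" if "x \<in> carrier TE" for x
      by (rule star_hom_eq_on_generated[OF TE(1) TF(1) _ \<phi>(1) TE(3) _ that]) (use \<mu> \<phi> in auto)
    then show "\<mu> = restrict \<phi> (carrier TE)"
      using \<mu> by (intro extensionalityI[of _ "carrier TE"]) auto
  qed (use \<phi> carr carr' in auto)
qed

end
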